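(* Let $n$ be a positive integer with $n\equiv1\pmod6$ satisfying one of: (a) $n\equiv0\pmod5$; (b) $n\ge186$, $n\equiv1\pmod5$; (c) $n\ge125$, $n\equiv2\pmod5$; (d) $n\equiv3\pmod5$; (e) $n\ge83$, $n\equiv4\pmod5$. Let $H$ be any abelian group of order $n^2+n+1$. Then there are no inverse-closed subsets $T_0,T_1\subseteq H$ with $e\in T_0$ satisfying $T_0T_1=H-e$ and $T_0^2+T_1^2=2H-T_0^{(2)}-T_1^{(2)}+2ne$ in $\mathbb{Z}[H]$.
   Context: $H$ is written multiplicatively with identity $e$; $\mathbb{Z}[H]$ is the integral group ring, a subset $D\subseteq H$ is identified with $\sum_{g\in D}g$, and $H$ also denotes $\sum_{h\in H}h$. For $A=\sum a_gg$ and $t\in\mathbb{Z}$, $A^{(t)}=\sum a_gg^t$. Inverse-closed means $T^{(-1)}=T$. *)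

theory Defs
  imports "HOL-Library.Poly_Mapping" "HOL-Library.Cardinality" "HOL-Number_Theory.Cong"
begin

text \<open>
  An abelian group \<open>H\<close> is rendered as a type of class \<open>ab_group_add\<close>, hence written additively:
  the product \<open>g h\<close> becomes \<open>g + h\<close>, the identity \<open>e\<close> becomes \<open>0\<close>, and \<open>g\<^sup>t\<close> becomes \<open>int_multiple t g\<close>.
  With this, \<open>'h \<Rightarrow>\<^sub>0 int\<close> with the convolution product of \<open>Poly_Mapping\<close> is the integral
  group ring \<open>\<int>[H]\<close>: \<open>Poly_Mapping.single g a\<close> is \<open>a g\<close>, and the ring unit \<open>1\<close> is
  \<open>Poly_Mapping.single 0 1\<close>, i.e. the group identity \<open>e\<close>.
\<close>

type_synonym 'h group_ring = "'h \<Rightarrow>\<^sub>0 int"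

definition int_multiple :: "int \<Rightarrow> 'h::ab_group_add \<Rightarrow> 'h" where
  "int_multiple t g =
     (if t \<ge> 0 then ((+) g ^^ nat t) 0 else - (((+) g ^^ nat (- t)) 0))"

text \<open>A subset \<open>D\<close> of \<open>H\<close> as an element of the group ring; \<open>H\<close> itself is \<open>set_elem UNIV\<close>.\<close>

definition set_elem :: "'h::{ab_group_add, finite} set \<Rightarrow> 'h group_ring" where
  "set_elem D = (\<Sum>g\<in>D. Poly_Mapping.single g 1)"

text \<open>\<open>A\<^sup>(\<^sup>t\<^sup>) = \<Sum> a\<^sub>g g\<^sup>t\<close> for \<open>A = \<Sum> a\<^sub>g g\<close>; this is not the ring power \<open>A ^ t\<close>.\<close>

definition elem_power :: "'h::ab_group_add group_ring \<Rightarrow> int \<Rightarrow> 'h group_ring" where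
  "elem_power A t =
     (\<Sum>g\<in>Poly_Mapping.keys A. Poly_Mapping.single (int_multiple t g) (Poly_Mapping.lookup A g))"

definition inverse_closed :: "'h::{ab_group_add, finite} set \<Rightarrow> bool" where
  "inverse_closed T \<longleftrightarrow> elem_power (set_elem T) (- 1) = set_elem T"

lemma lookup_set_elem:
  "Poly_Mapping.lookup (set_elem D) g = (if g \<in> D then 1 else 0)"
proof -
  have "Poly_Mapping.lookup (set_elem D) g = (\<Sum>x\<in>D. if x = g then 1 else 0)"
    unfolding set_elem_def lookup_sum by (simp add: lookup_single when_def)
  then show ?thesis by simp
qed

lemma keys_set_elem: "Poly_Mapping.keys (set_elem D) = D"
  by (auto simp: in_keys_iff lookup_set_elem split: if_splits)

lemma elem_power_set_elem:
  "elem_power (set_elem D) t = (\<Sum>g\<in>D. Poly_Mapping.single (int_multiple t g) 1)"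
  by (simp add: elem_power_def keys_set_elem lookup_set_elem)

lemma inverse_closed_iff: "inverse_closed T \<longleftrightarrow> uminus ` T = T"
proof -
  have "elem_power (set_elem T) (- 1) = set_elem (uminus ` T)"
    unfolding elem_power_set_elem by (simp add: int_multiple_def set_elem_def sum.reindex)
  moreover have "set_elem A = set_elem B \<longleftrightarrow> A = B" for A B :: "'a set"
    by (metis keys_set_elem)
  ultimately show ?thesis by (simp add: inverse_closed_def)
qed

end

theory Submission
  imports Defs
begin

text \<open>
  Augmentation and parity force \<open>|T0| = n\<close> and
  \<open>|T1| = n + 1\<close>. Put \<open>S = T0\<^sup>(\<^sup>2\<^sup>) + T1\<^sup>(\<^sup>2\<^sup>)\<close> and \<open>X = T0 S\<close>. The two equations give
  \<open>X = (n - 1) H + 2n T0 - T0\<^sup>3 + T1\<close>, so for \<open>n \<equiv> 1 (mod 3)\<close> the coefficients of \<open>X\<close> are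
  congruent to those of \<open>T1 - T0 - T0\<^sup>(\<^sup>3\<^sup>)\<close> modulo 3. They also give
  \<open>S\<^sup>2 = 4H - S\<^sup>(\<^sup>2\<^sup>) + 2n - 2\<close>, whence the sum of \<open>X\<^sub>g (X\<^sub>g - 3)\<close> over all \<open>g\<close> is at most
  \<open>- 6n\<close>. A summand is negative only where \<open>X\<^sub>g\<close> is 1 or 2, where it equals \<open>- 2\<close>, and this
  requires \<open>g\<close> to lie in the support of \<open>w = T0 + T1 + T0\<^sup>(\<^sup>3\<^sup>) - e\<close>, of total weight \<open>3n\<close>.
  So equality holds everywhere, and then \<open>X\<^sub>g = 1\<close> for all \<open>g \<in> T1\<close>. But the sum of \<open>X\<^sub>g\<close> over
  \<open>T1\<close> is the coefficient of \<open>e\<close> in \<open>T0 T1 S = (H - e) S\<close>, namely \<open>2n\<close>. Hence \<open>n + 1 = 2n\<close>,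
  so \<open>n = 1\<close>, which the bound in case (b) excludes.
\<close>

abbreviation lookup :: "('a \<Rightarrow>\<^sub>0 'b::zero) \<Rightarrow> 'a \<Rightarrow> 'b" where
  "lookup \<equiv> Poly_Mapping.lookup"

section \<open>Coefficients of products in the group ring\<close>

lemma eq_sum_single:
  fixes f :: "'h::finite \<Rightarrow>\<^sub>0 int"
  shows "f = (\<Sum>x\<in>UNIV. Poly_Mapping.single x (lookup f x))"
  by (rule poly_mapping_eqI) (simp add: lookup_sum lookup_single when_def)

lemma lookup_mult_group:
  fixes f g :: "'h::{ab_group_add, finite} group_ring"
  shows "lookup (f * g) k = (\<Sum>x\<in>UNIV. lookup f x * lookup g (k - x))"
proof -
  have "f * g = (\<Sum>x\<in>UNIV. \<Sum>y\<in>UNIV. Poly_Mapping.single (x + y) (lookup f x * lookup g y))"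
    by (subst eq_sum_single[of f], subst eq_sum_single[of g])
       (simp add: sum_product mult_single)
  then have "lookup (f * g) k
      = (\<Sum>x\<in>UNIV. \<Sum>y\<in>UNIV. lookup f x * lookup g y when x + y = k)"
    by (simp add: lookup_sum lookup_single)
  also have "\<dots> = (\<Sum>x\<in>UNIV. \<Sum>y\<in>UNIV. if y = k - x then lookup f x * lookup g y else 0)"
    by (intro sum.cong refl) (auto simp: when_def algebra_simps)
  finally show ?thesis by simp
qed

lemma lookup_single_0_mult:
  fixes f :: "'h::{ab_group_add, finite} group_ring"
  shows "lookup (Poly_Mapping.single 0 c * f) k = c * lookup f k"
proof -
  have "(\<Sum>x\<in>UNIV. lookup (Poly_Mapping.single 0 c) x * lookup f (k - x))
      = (\<Sum>x :: 'h\<in>UNIV. if x = 0 then c * lookup f k else 0)"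
    by (intro sum.cong refl) (auto simp: lookup_single when_def)
  then show ?thesis
    by (simp add: lookup_mult_group)
qed

lemma single_0_int: "Poly_Mapping.single 0 (c :: int) = of_int c"
  by (metis single_of_int of_int_eq_id id_apply)

lemma lookup_of_int_0: "lookup (of_int c :: 'h::{ab_group_add, finite} group_ring) 0 = c"
  by (simp flip: single_0_int)

lemma lookup_of_int_mult:
  fixes f :: "'h::{ab_group_add, finite} group_ring"
  shows "lookup (of_int c * f) k = c * lookup f k"
  using lookup_single_0_mult[of c f k] by (simp only: single_0_int)

lemma lookup_numeral_mult:
  fixes f :: "'h::{ab_group_add, finite} group_ring"
  shows "lookup (numeral c * f) k = numeral c * lookup f k"
  using lookup_single_0_mult[of "numeral c" f k] by simp

section \<open>Augmentation\<close>

definition augmentation :: "'h::{ab_group_add, finite} group_ring \<Rightarrow> int" where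
  "augmentation f = (\<Sum>x\<in>UNIV. lookup f x)"

lemma augmentation_add: "augmentation (f + g) = augmentation f + augmentation g"
  by (simp add: augmentation_def lookup_add sum.distrib)

lemma augmentation_diff: "augmentation (f - g) = augmentation f - augmentation g"
  by (simp add: augmentation_def lookup_minus sum_subtractf)

lemma augmentation_single: "augmentation (Poly_Mapping.single a c) = c"
  by (simp add: augmentation_def lookup_single when_def)

lemma augmentation_of_int: "augmentation (of_int c) = c"
  using augmentation_single[of 0 c] by (simp only: single_0_int)

lemma augmentation_sum: "augmentation (\<Sum>i\<in>I. f i) = (\<Sum>i\<in>I. augmentation (f i))"
  by (simp add: augmentation_def lookup_sum sum.swap[of _ UNIV])

lemma augmentation_set_elem: "augmentation (set_elem D) = int (card D)"
  by (simp add: set_elem_def augmentation_sum augmentation_single)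

lemma lookup_mult_set_elem_UNIV:
  "lookup (f * set_elem UNIV) k = augmentation f"
  by (simp add: lookup_mult_group augmentation_def lookup_set_elem)

lemma mult_set_elem_UNIV: "f * set_elem UNIV = of_int (augmentation f) * set_elem UNIV"
  by (rule poly_mapping_eqI)
     (subst lookup_mult_set_elem_UNIV, subst lookup_of_int_mult, simp add: lookup_set_elem)

text \<open>Multiplying by \<open>H\<close> turns an element into its augmentation times
  \<open>H\<close>, so bracketing \<open>f * g * H\<close> in two ways gives
  multiplicativity.\<close>

lemma augmentation_mult: "augmentation (f * g) = augmentation f * augmentation g"
proof -
  have "f * g * set_elem UNIV = f * (g * set_elem UNIV)"
    by (rule mult.assoc)
  also have "\<dots> = of_int (augmentation g) * (f * set_elem UNIV)"
    by (subst mult_set_elem_UNIV[of g]) (rule mult.left_commute)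
  finally have "lookup (f * g * set_elem UNIV) 0 = augmentation g * augmentation f"
    by (simp only: lookup_of_int_mult lookup_mult_set_elem_UNIV)
  then show ?thesis
    by (simp add: lookup_mult_set_elem_UNIV)
qed

section \<open>The power maps on the group ring\<close>

lemma int_multiple_2: "int_multiple 2 g = g + g"
  by (simp add: int_multiple_def numeral_2_eq_2)

lemma int_multiple_3: "int_multiple 3 g = g + g + g"
  by (simp add: int_multiple_def numeral_3_eq_3 add.assoc)

lemma elem_power_UNIV:
  fixes A :: "'h::{ab_group_add, finite} group_ring"
  shows "elem_power A t = (\<Sum>g\<in>UNIV. Poly_Mapping.single (int_multiple t g) (lookup A g))"
  unfolding elem_power_def by (rule sum.mono_neutral_left) (auto simp: in_keys_iff)

lemma elem_power_add:
  fixes A :: "'h::{ab_group_add, finite} group_ring"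
  shows "elem_power (A + B) t = elem_power A t + elem_power B t"
  by (simp add: elem_power_UNIV lookup_add single_add sum.distrib)

lemma elem_power_diff:
  fixes A :: "'h::{ab_group_add, finite} group_ring"
  shows "elem_power (A - B) t = elem_power A t - elem_power B t"
  by (simp add: elem_power_UNIV lookup_minus single_diff sum_subtractf)

lemma elem_power_single: "elem_power (Poly_Mapping.single a c) t = Poly_Mapping.single (int_multiple t a) c"
  by (cases "c = 0") (simp_all add: elem_power_def)

lemma elem_power_sum:
  fixes A :: "'i \<Rightarrow> 'h::{ab_group_add, finite} group_ring"
  shows "elem_power (\<Sum>i\<in>I. A i) t = (\<Sum>i\<in>I. elem_power (A i) t)"
  by (induction I rule: infinite_finite_induct) (simp_all add: elem_power_add, simp_all add: elem_power_def)

text \<open>Doubling is an endomorphism of an abelian group, so its linear extension respects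
  convolution.\<close>

lemma elem_power_2_mult:
  fixes A B :: "'h::{ab_group_add, finite} group_ring"
  shows "elem_power (A * B) 2 = elem_power A 2 * elem_power B 2"
proof -
  have "A * B = (\<Sum>x\<in>UNIV. \<Sum>y\<in>UNIV. Poly_Mapping.single (x + y) (lookup A x * lookup B y))"
    by (subst eq_sum_single[of A], subst eq_sum_single[of B])
       (simp add: sum_product mult_single)
  then have "elem_power (A * B) 2
      = (\<Sum>x\<in>UNIV. \<Sum>y\<in>UNIV. Poly_Mapping.single (x + y + (x + y)) (lookup A x * lookup B y))"
    by (simp add: elem_power_sum elem_power_single int_multiple_2)
  also have "\<dots> = (\<Sum>x\<in>UNIV. \<Sum>y\<in>UNIV. Poly_Mapping.single (x + x) (lookup A x)
                   * Poly_Mapping.single (y + y) (lookup B y))"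
    by (intro sum.cong refl) (simp add: mult_single algebra_simps)
  finally show ?thesis
    by (simp add: elem_power_UNIV int_multiple_2 sum_product)
qed

lemma elem_power_of_int: "elem_power (of_int c) 2 = of_int c"
  using elem_power_single[of 0 c 2] by (simp add: int_multiple_2 single_0_int)

lemma lookup_elem_power:
  fixes A :: "'h::{ab_group_add, finite} group_ring"
  shows "lookup (elem_power A t) k = (\<Sum>g\<in>UNIV. if int_multiple t g = k then lookup A g else 0)"
  by (simp add: elem_power_UNIV lookup_sum lookup_single when_def)

lemma elem_power_nonneg:
  fixes A :: "'h::{ab_group_add, finite} group_ring"
  assumes "\<And>x. lookup A x \<ge> 0"
  shows "lookup (elem_power A t) k \<ge> 0"
  using assms by (simp add: lookup_elem_power sum_nonneg)

lemma lookup_elem_power_0_ge: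
  fixes A :: "'h::{ab_group_add, finite} group_ring"
  assumes "\<And>x. lookup A x \<ge> 0" and "int_multiple t (0 :: 'h) = 0"
  shows "lookup (elem_power A t) 0 \<ge> lookup A 0"
proof -
  have "(if int_multiple t (0 :: 'h) = 0 then lookup A 0 else 0)
      \<le> (\<Sum>g\<in>UNIV. if int_multiple t g = 0 then lookup A g else 0)"
    by (rule member_le_sum) (auto simp: assms)
  then show ?thesis
    by (simp add: lookup_elem_power assms)
qed

lemma augmentation_elem_power:
  fixes A :: "'h::{ab_group_add, finite} group_ring"
  shows "augmentation (elem_power A t) = augmentation A"
  by (simp add: elem_power_UNIV augmentation_sum augmentation_single)
     (simp add: augmentation_def)

section \<open>Elements invariant under inversion\<close>

definition symmetric :: "'h::{ab_group_add, finite} group_ring \<Rightarrow> bool" where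
  "symmetric f \<longleftrightarrow> (\<forall>x. lookup f (- x) = lookup f x)"

lemma sum_uminus_UNIV:
  fixes f :: "'h::{ab_group_add, finite} \<Rightarrow> int"
  shows "(\<Sum>x\<in>UNIV. f (- x)) = (\<Sum>x\<in>UNIV. f x)"
  by (rule sum.reindex_bij_witness[of _ uminus uminus]) auto

lemma symmetric_set_elem: "inverse_closed T \<Longrightarrow> symmetric (set_elem T)"
  unfolding inverse_closed_iff symmetric_def lookup_set_elem
  by (metis imageI minus_minus)

lemma symmetric_add: "symmetric f \<Longrightarrow> symmetric g \<Longrightarrow> symmetric (f + g)"
  by (simp add: symmetric_def lookup_add)

lemma symmetric_mult:
  assumes "symmetric f" "symmetric g"
  shows "symmetric (f * g)"
  unfolding symmetric_def
proof
  fix k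
  have "lookup (f * g) (- k) = (\<Sum>x\<in>UNIV. lookup f (- x) * lookup g (- k - - x))"
    by (simp only: lookup_mult_group sum_uminus_UNIV[of "\<lambda>x. lookup f x * lookup g (- k - x)"])
  also have "\<dots> = (\<Sum>x\<in>UNIV. lookup f x * lookup g (k - x))"
  proof (intro sum.cong refl)
    fix x
    have "- k - - x = - (k - x)"
      by simp
    then show "lookup f (- x) * lookup g (- k - - x) = lookup f x * lookup g (k - x)"
      using assms by (metis symmetric_def)
  qed
  finally show "lookup (f * g) (- k) = lookup (f * g) k"
    by (simp only: lookup_mult_group)
qed

lemma symmetric_elem_power_2:
  assumes "symmetric f"
  shows "symmetric (elem_power f 2)"
  unfolding symmetric_def
proof
  fix k
  have "lookup (elem_power f 2) (- k)
      = (\<Sum>g\<in>UNIV. if int_multiple 2 (- g) = - k then lookup f (- g) else 0)"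
    by (simp only: lookup_elem_power
        sum_uminus_UNIV[of "\<lambda>g. if int_multiple 2 g = - k then lookup f g else 0"])
  also have "\<dots> = (\<Sum>g\<in>UNIV. if int_multiple 2 g = k then lookup f g else 0)"
  proof (intro sum.cong refl)
    fix g
    have "- g + - g = - k \<longleftrightarrow> g + g = k"
      by (metis minus_add_distrib minus_minus)
    then show "(if int_multiple 2 (- g) = - k then lookup f (- g) else 0)
        = (if int_multiple 2 g = k then lookup f g else 0)"
      using assms by (simp add: int_multiple_2 symmetric_def)
  qed
  finally show "lookup (elem_power f 2) (- k) = lookup (elem_power f 2) k"
    by (simp add: lookup_elem_power)
qed

text \<open>Turns a coefficient at the identity into an inner product. It gives the disjointness of
  \<open>T0\<close> and \<open>T1\<close>, the sum of squares of the coefficients of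
  \<open>X\<close>, and the sum of \<open>X\<close> over \<open>T1\<close>.\<close>

lemma lookup_mult_symmetric_0:
  assumes "symmetric g"
  shows "lookup (f * g) 0 = (\<Sum>x\<in>UNIV. lookup f x * lookup g x)"
  using assms by (simp add: lookup_mult_group symmetric_def)

text \<open>Frobenius modulo 3: when one group element is added to \<open>D\<close>, the cross terms
  of the cube are multiples of 3.\<close>

lemma set_elem_cube:
  fixes D :: "'h::{ab_group_add, finite} set"
  obtains q where "set_elem D ^ 3 = elem_power (set_elem D) 3 + 3 * q"
proof -
  have "\<exists>q. set_elem D ^ 3 = elem_power (set_elem D) 3 + 3 * q"
    using finite[of D]
  proof (induction D rule: finite_induct)
    case empty
    then show ?case
      by (intro exI[of _ 0]) (simp add: set_elem_def elem_power_def)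
  next
    case (insert a D)
    then obtain q where q: "set_elem D ^ 3 = elem_power (set_elem D) 3 + 3 * q"
      by blast
    let ?x = "Poly_Mapping.single a (1::int)"
    have ins: "set_elem (insert a D) = ?x + set_elem D"
      using insert.hyps by (simp add: set_elem_def)
    have x: "?x ^ 3 = elem_power ?x 3"
      by (simp add: elem_power_single int_multiple_3 power3_eq_cube mult_single)
    have "(?x + set_elem D) ^ 3
        = ?x ^ 3 + set_elem D ^ 3 + 3 * (?x\<^sup>2 * set_elem D + ?x * (set_elem D)\<^sup>2)"
      by (simp add: power3_eq_cube power2_eq_square algebra_simps)
    also have "\<dots> = elem_power (?x + set_elem D) 3
        + 3 * (q + ?x\<^sup>2 * set_elem D + ?x * (set_elem D)\<^sup>2)"
      by (simp add: x q elem_power_add algebra_simps)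
    finally show ?case
      unfolding ins by blast
  qed
  then show ?thesis
    using that by blast
qed

section \<open>Groups of odd order and parity of symmetric sets\<close>

lemma doubling_eq_0_odd_order:
  fixes d :: "'h::{ab_group_add, finite}"
  assumes "odd CARD('h)" and "d + d = 0"
  shows "d = 0"
proof -
  \<comment> \<open>Translation by \<open>d\<close> permutes the group, so \<open>d\<close> added to
    itself \<open>CARD('h)\<close> times is 0; since \<open>d + d = 0\<close>, this odd multiple
    equals \<open>d\<close>.\<close>
  have "(\<Sum>x\<in>UNIV. x + d) = (\<Sum>x\<in>UNIV. x)"
    by (rule sum.reindex_bij_witness[of _ "\<lambda>x. x - d" "\<lambda>x. x + d"]) auto
  then have *: "(\<Sum>x\<in>(UNIV :: 'h set). d) = 0"
    by (simp add: sum.distrib)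
  have "(\<Sum>x\<in>A. d) = (if even (card A) then 0 else d)" if "finite A" for A :: "'h set"
    using that by (induction A rule: finite_induct) (auto simp: assms(2))
  from this[of UNIV] * assms(1) show ?thesis
    by simp
qed

lemma elem_power_2_set_elem_UNIV:
  assumes "odd CARD('h::{ab_group_add, finite})"
  shows "elem_power (set_elem (UNIV :: 'h set)) 2 = set_elem UNIV"
proof -
  have "inj (\<lambda>x :: 'h. x + x)"
  proof (rule injI)
    fix x y :: 'h
    assume eq: "x + x = y + y"
    have "(x - y) + (x - y) = (x + x) - (y + y)"
      by (simp add: algebra_simps)
    also have "\<dots> = 0"
      by (simp only: eq diff_self)
    finally show "x = y"
      using doubling_eq_0_odd_order[OF assms, of "x - y"] by (simp only: right_minus_eq)
  qed
  then have "bij (\<lambda>x :: 'h. x + x)"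
    by (simp add: finite_UNIV_inj_surj bij_def)
  from sum.reindex_bij_betw[OF this, of "\<lambda>y. Poly_Mapping.single y (1::int)"]
  show ?thesis
    by (simp only: elem_power_set_elem int_multiple_2) (simp only: set_elem_def)
qed

text \<open>Induction on the cardinality, removing one two-element orbit at a time.\<close>

lemma even_card_fixpoint_free_involution:
  assumes "finite A" and "\<And>x. x \<in> A \<Longrightarrow> f x \<in> A \<and> f (f x) = x \<and> f x \<noteq> x"
  shows "even (card A)"
  using assms
proof (induction "card A" arbitrary: A rule: less_induct)
  case less
  show ?case
  proof (cases "A = {}")
    case False
    then obtain a where a: "a \<in> A" by blast
    let ?B = "A - {a, f a}"
    have two: "card {a, f a} = 2" and sub: "{a, f a} \<subseteq> A"
      using less.prems(2)[OF a] a by auto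
    have cB: "card A = card ?B + 2"
      using card_Diff_subset[OF _ sub] card_mono[OF less.prems(1) sub] two by simp
    have "f x \<in> ?B \<and> f (f x) = x \<and> f x \<noteq> x" if "x \<in> ?B" for x
      using that less.prems(2)[of x] less.prems(2)[OF a] by (metis DiffE DiffI insert_iff empty_iff)
    then have "even (card ?B)"
      using less.hyps[of ?B] cB less.prems(1) by simp
    then show ?thesis
      using cB by simp
  qed simp
qed

text \<open>Negation pairs off the nonzero elements of \<open>T\<close>, none of which is its own
  negative in odd order; only 0 is left over.\<close>

lemma odd_card_inverse_closed:
  fixes T :: "'h::{ab_group_add, finite} set"
  assumes "odd CARD('h)" and "inverse_closed T" and "0 \<in> T"
  shows "odd (card T)"
proof -
  have "- x \<in> T - {0} \<and> - (- x) = x \<and> - x \<noteq> x" if "x \<in> T - {0}" for x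
  proof -
    have "- x \<in> T"
      using assms(2) that by (auto simp: inverse_closed_iff)
    moreover have "- x \<noteq> x"
      using doubling_eq_0_odd_order[OF assms(1), of x] that
      by (metis DiffE add.right_inverse insertI1)
    ultimately show ?thesis
      using that by auto
  qed
  then have "even (card (T - {0}))"
    by (intro even_card_fixpoint_free_involution[of _ uminus]) auto
  moreover have "card T = Suc (card (T - {0}))"
    by (rule card.remove) (simp_all add: assms(3))
  ultimately show ?thesis
    by simp
qed

theorem theorem7p5:
  fixes n :: nat
  assumes "n > 0"
    and "[n = 1] (mod 6)"
    and "[n = 0] (mod 5)
       \<or> (n \<ge> 186 \<and> [n = 1] (mod 5))
       \<or> (n \<ge> 125 \<and> [n = 2] (mod 5))
       \<or> [n = 3] (mod 5)
       \<or> (n \<ge> 83 \<and> [n = 4] (mod 5))"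
    and "CARD('h::{ab_group_add, finite}) = n ^ 2 + n + 1"
  shows "\<not> (\<exists>T0 T1 :: 'h set.
            inverse_closed T0 \<and> inverse_closed T1 \<and> 0 \<in> T0
          \<and> set_elem T0 * set_elem T1 = set_elem UNIV - 1
          \<and> set_elem T0 ^ 2 + set_elem T1 ^ 2
              = 2 * set_elem UNIV - elem_power (set_elem T0) 2 - elem_power (set_elem T1) 2
                + of_nat (2 * n))"
proof
  let ?H = "set_elem (UNIV :: 'h set)"
  assume "\<exists>T0 T1 :: 'h set.
            inverse_closed T0 \<and> inverse_closed T1 \<and> 0 \<in> T0
          \<and> set_elem T0 * set_elem T1 = ?H - 1
          \<and> set_elem T0 ^ 2 + set_elem T1 ^ 2
              = 2 * ?H - elem_power (set_elem T0) 2 - elem_power (set_elem T1) 2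
                + of_nat (2 * n)"
  then obtain T0 T1 :: "'h set" where inv: "inverse_closed T0" "inverse_closed T1" and "0 \<in> T0"
    and prod: "set_elem T0 * set_elem T1 = ?H - 1"
    and squares: "set_elem T0 ^ 2 + set_elem T1 ^ 2
              = 2 * ?H - elem_power (set_elem T0) 2 - elem_power (set_elem T1) 2
                + of_nat (2 * n)"
    by blast
  define A where "A = set_elem T0"
  define B where "B = set_elem T1"
  define N where "N = int n"
  define S where "S = elem_power (A + B) 2"
  define X where "X = A * S"
  define C where "C = elem_power A 3"
  have "n mod 6 = 1" and "n \<noteq> 1"
    using assms(2,3) by (auto simp: cong_def)
  then obtain m where m: "n = 6 * m + 1"
    by (metis mult_div_mod_eq)
  have N: "N > 1"
    using \<open>n \<noteq> 1\<close> m by (simp add: N_def)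
  have odd: "odd CARD('h)"
    using m by (simp add: assms(4))
  have AB: "A * B = ?H - 1"
    using prod by (simp add: A_def B_def)
  have sq: "A * A + B * B = 2 * ?H - S + of_int (2 * N)"
    using squares by (simp add: A_def B_def S_def N_def elem_power_add power2_eq_square)

  have symA: "symmetric A" and symB: "symmetric B"
    using inv by (simp_all add: A_def B_def symmetric_set_elem)
  then have symS: "symmetric S"
    by (simp add: S_def symmetric_add symmetric_elem_power_2)
  then have symX: "symmetric X"
    by (simp add: X_def symmetric_mult symA)

  \<comment> \<open>The sizes of \<open>T0\<close> and \<open>T1\<close>\<close>
  define a where "a = int (card T0)"
  define b where "b = int (card T1)"
  have augA: "augmentation A = a" and augB: "augmentation B = b"
    by (simp_all add: A_def B_def a_def b_def augmentation_set_elem)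
  have augH: "augmentation ?H = N\<^sup>2 + N + 1"
    by (simp add: augmentation_set_elem assms(4) N_def)
  have augS: "augmentation S = a + b"
    by (simp add: S_def augmentation_elem_power augmentation_add augA augB)
  have ab: "a * b = N\<^sup>2 + N"
    using arg_cong[OF AB, of augmentation] augmentation_of_int[where ?'a='h, of 1]
    by (simp add: augmentation_mult augmentation_diff augA augB augH)
  have "a * a + b * b = 2 * (N\<^sup>2 + N + 1) - (a + b) + 2 * N"
    using arg_cong[OF sq, of augmentation] augmentation_of_int[where ?'a='h, of 2]
      augmentation_of_int[where ?'a='h, of "2 * N"]
    by (simp add: augmentation_mult augmentation_diff augmentation_add augA augB augH augS)
  \<comment> \<open>With \<open>s = a + b\<close>, adding \<open>2 * a * b\<close> to both sides
    gives \<open>s^2 + s = (2 * N + 1) * (2 * N + 2)\<close>.\<close>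
  with ab have "(a + b - (2 * N + 1)) * (a + b + 2 * N + 2) = 0"
    by algebra
  moreover have "a + b + 2 * N + 2 > 0"
    using N by (simp add: a_def b_def)
  ultimately have a_b: "b = 2 * N + 1 - a"
    by auto
  with ab have "(a - N) * (a - (N + 1)) = 0"
    by algebra
  moreover have "odd a"
    using odd_card_inverse_closed[OF odd inv(1) \<open>0 \<in> T0\<close>] by (simp add: a_def)
  moreover have "odd N"
    by (simp add: N_def m)
  ultimately have a: "a = N"
    by auto
  with a_b have b: "b = N + 1"
    by simp

  have lA: "lookup A g = (if g \<in> T0 then 1 else 0)"
    and lB: "lookup B g = (if g \<in> T1 then 1 else 0)" for g
    by (simp_all add: A_def B_def lookup_set_elem)
  have disj: "\<not> (g \<in> T0 \<and> g \<in> T1)" for g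
  proof -
    \<comment> \<open>By symmetry of \<open>B\<close> this sum is the coefficient of
      \<open>A * B = H - 1\<close> at 0.\<close>
    have "(\<Sum>x\<in>UNIV. lookup A x * lookup B x) = 0"
      using lookup_mult_symmetric_0[OF symB, of A] by (simp add: AB lookup_minus lookup_set_elem)
    moreover have "lookup A x * lookup B x \<ge> 0" for x
      by (simp add: lA lB)
    ultimately have "lookup A g * lookup B g = 0"
      by (simp add: sum_nonneg_eq_0_iff)
    then show ?thesis
      by (simp add: lA lB split: if_splits)
  qed

  have AA0: "lookup (A * A) 0 = N"
    using augA by (simp add: lookup_mult_symmetric_0[OF symA] augmentation_def a lA
        if_distrib cong: if_cong)
  have BB0: "lookup (B * B) 0 = N + 1"
    using augB by (simp add: lookup_mult_symmetric_0[OF symB] augmentation_def b lB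
        if_distrib cong: if_cong)
  \<comment> \<open>At 0, \<open>sq\<close> reads
    \<open>N + (N + 1) = 2 - lookup S 0 + 2 * N\<close>.\<close>
  have S0: "lookup S 0 = 1"
    using arg_cong[OF sq, of "\<lambda>f. lookup f 0"]
    by (simp add: lookup_add lookup_minus lookup_numeral_mult lookup_set_elem lookup_of_int_0
        AA0 BB0 del: of_int_mult)

  \<comment> \<open>The sum of squares of the coefficients of \<open>X\<close>\<close>
  define S4 where "S4 = elem_power S 2"
  have "(A + B) * (A + B) = (A * A + B * B) + 2 * (A * B)"
    by (simp add: algebra_simps)
  also have "\<dots> = of_int 4 * ?H - S + of_int (2 * N - 2)"
    by (simp add: AB sq algebra_simps)
  \<comment> \<open>Doubling carries \<open>A + B\<close> to \<open>S\<close> and \<open>S\<close>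
    to \<open>S4\<close>, and fixes integers and, the order being odd, \<open>H\<close>. It
    therefore turns the formula for \<open>(A + B)^2\<close> into one for
    \<open>S * S\<close>.\<close>
  finally have "elem_power ((A + B) * (A + B)) 2
      = elem_power (of_int 4 * ?H - S + of_int (2 * N - 2)) 2"
    by simp
  then have SS: "S * S = of_int 4 * ?H - S4 + of_int (2 * N - 2)"
    by (simp only: elem_power_2_mult elem_power_add elem_power_diff elem_power_of_int
        elem_power_2_set_elem_UNIV[OF odd] S_def S4_def)

  have S_nonneg: "lookup S g \<ge> 0" for g
    by (simp add: S_def elem_power_nonneg lookup_add lA lB)
  \<comment> \<open>All coefficients are nonnegative, so keeping only the term at 0 of the
    convolution bounds it below.\<close>
  have AAS4: "lookup (A * A * S4) 0 \<ge> N"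
  proof -
    have "lookup S4 0 \<ge> 1"
      using lookup_elem_power_0_ge[of S 2] S_nonneg S0 by (simp add: S4_def int_multiple_2)
    moreover have "lookup (A * A) 0 * lookup S4 (0 - 0)
        \<le> (\<Sum>x\<in>UNIV. lookup (A * A) x * lookup S4 (0 - x))"
    proof (rule member_le_sum)
      fix x
      have "lookup (A * A) x \<ge> 0"
        by (simp add: lookup_mult_group lA sum_nonneg)
      then show "0 \<le> lookup (A * A) x * lookup S4 (0 - x)"
        by (simp add: S4_def elem_power_nonneg S_nonneg)
    qed simp_all
    moreover have "N * 1 \<le> N * lookup S4 0" if "lookup S4 0 \<ge> 1"
      using that N by (intro mult_left_mono) auto
    ultimately show ?thesis
      by (simp add: lookup_mult_group[of "A * A" S4] AA0)
  qed
  have "X * X = of_int 4 * (A * A * ?H) - A * A * S4 + of_int (2 * N - 2) * (A * A)"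
  proof -
    have "X * X = A * A * (S * S)"
      by (simp add: X_def algebra_simps)
    then show ?thesis
      by (simp only: SS) (simp add: algebra_simps)
  qed
  then have "lookup (X * X) 0
      = 4 * (N * N) - lookup (A * A * S4) 0 + (2 * N - 2) * N"
    by (simp only: lookup_add lookup_minus lookup_of_int_mult lookup_mult_set_elem_UNIV
        augmentation_mult augA a AA0)
  then have sum_XX: "(\<Sum>g\<in>UNIV. lookup X g * lookup X g) \<le> 4 * (N * N) - N + (2 * N - 2) * N"
    using AAS4 by (simp add: lookup_mult_symmetric_0[OF symX])
  have sum_X: "(\<Sum>g\<in>UNIV. lookup X g) = N * (2 * N + 1)"
    using augmentation_mult[of A S] unfolding augmentation_def[of "A * S"]
    by (simp add: X_def augA augS a b)

  \<comment> \<open>The coefficients of \<open>X\<close> modulo 3\<close>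
  have lC: "lookup C g \<ge> 0" for g
    by (simp add: C_def elem_power_nonneg lA)
  have C0: "lookup C 0 \<ge> 1"
    using lookup_elem_power_0_ge[of A 3] \<open>0 \<in> T0\<close> by (simp add: C_def int_multiple_3 lA)
  have augC: "augmentation C = N"
    by (simp add: C_def augmentation_elem_power augA a)
  have X_mod: "3 dvd lookup X g - (lookup B g - lookup A g - lookup C g)" for g
  proof -
    obtain q where q: "A ^ 3 = C + 3 * q"
      using set_elem_cube[of T0] by (auto simp: A_def C_def)
    have "X = A * (2 * ?H + of_int (2 * N) - (A * A + B * B))"
      by (simp add: sq X_def algebra_simps)
    also have "\<dots> = 2 * (A * ?H) + of_int (2 * N) * A - A ^ 3 - A * B * B"
      by (simp add: algebra_simps power3_eq_cube)
    also have "\<dots> = 2 * (A * ?H) + of_int (2 * N) * A - (C + 3 * q) - B * ?H + B"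
      by (simp add: AB q algebra_simps)
    finally have "lookup X g = 2 * N + 2 * N * lookup A g - (lookup C g + 3 * lookup q g)
        - (N + 1) + lookup B g"
      by (simp only: lookup_add lookup_minus lookup_of_int_mult lookup_numeral_mult
          lookup_mult_set_elem_UNIV augA augB a b)
    \<comment> \<open>Apart from \<open>3 * lookup q g\<close>, what remains is
      \<open>N - 1 + (2 * N + 1) * lookup A g\<close>; both constants are multiples of 3 because
      \<open>N = 6 * m + 1\<close>.\<close>
    then have "lookup X g - (lookup B g - lookup A g - lookup C g)
        = 3 * (2 * int m + (4 * int m + 1) * lookup A g - lookup q g)"
      by (simp add: N_def m algebra_simps)
    then show ?thesis
      by simp
  qed
  have X_nonneg: "lookup X g \<ge> 0" for g
    by (simp add: X_def lookup_mult_group lA S_nonneg sum_nonneg)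

  \<comment> \<open>Comparison of \<open>X\<close> with the weight \<open>w\<close>\<close>
  define w where "w g = lookup A g + lookup B g + lookup C g - (if g = 0 then 1 else 0)" for g
  \<comment> \<open>At 0 both \<open>A\<close> and \<open>C\<close> contribute, so subtracting 1
    there keeps \<open>w 0\<close> at least 1 and lowers the total from \<open>3 * N + 1\<close> to
    \<open>3 * N\<close>, the value that leaves no slack below.\<close>
  have "(\<Sum>g\<in>UNIV. w g) = augmentation A + augmentation B + augmentation C - 1"
    by (simp add: w_def augmentation_def sum.distrib sum_subtractf)
  then have sum_w: "(\<Sum>g\<in>UNIV. w g) = 3 * N"
    by (simp add: augA augB augC a b)
  have small: "x * (x - 3) \<ge> (if 3 dvd x then 0 else -2)" if "x \<ge> 0" for x :: int
  proof (cases "x \<ge> 3")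
    case True
    then have "x * (x - 3) \<ge> 0"
      by simp
    then show ?thesis
      by simp
  next
    case False
    then have "x = 0 \<or> x = 1 \<or> x = 2"
      using that by auto
    then show ?thesis
      by auto
  qed
  have pos: "lookup X g * (lookup X g - 3) + 2 * w g \<ge> 0" for g
  proof (cases "w g \<ge> 1")
    case True
    then show ?thesis
      using small[OF X_nonneg[of g]] by (auto split: if_splits)
  next
    case False
    have "g \<noteq> 0"
      using False C0 \<open>0 \<in> T0\<close> by (auto simp: w_def lA lB split: if_splits)
    then have "lookup A g = 0" "lookup B g = 0" "lookup C g = 0" "w g = 0"
      using False lC[of g] by (auto simp: w_def lA lB split: if_splits)
    then show ?thesis
      using small[OF X_nonneg[of g]] X_mod[of g] by simp
  qed
  have "(\<Sum>g\<in>UNIV. lookup X g * (lookup X g - 3) + 2 * w g)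
      = (\<Sum>g\<in>UNIV. lookup X g * lookup X g) - 3 * (\<Sum>g\<in>UNIV. lookup X g) + 2 * (\<Sum>g\<in>UNIV. w g)"
    by (simp add: sum.distrib sum_subtractf right_diff_distrib mult.commute[of _ 3]
        flip: sum_distrib_left)
  \<comment> \<open>The bounds cancel exactly:
    \<open>(6 * N^2 - 3 * N) - 3 * (2 * N^2 + N) + 6 * N = 0\<close>. A sum of nonnegative terms
    that is at most 0 vanishes termwise.\<close>
  also have "\<dots> \<le> 0"
    using sum_XX by (simp add: sum_X sum_w algebra_simps)
  finally have eq0: "lookup X g * (lookup X g - 3) + 2 * w g = 0" for g
    using pos sum_nonneg_eq_0_iff[of UNIV "\<lambda>g. lookup X g * (lookup X g - 3) + 2 * w g"]
    by (simp add: order_antisym sum_nonneg)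
  have X_T1: "lookup X g = 1" if "g \<in> T1" for g
  proof -
    have g: "lookup A g = 0" "lookup B g = 1" "g \<noteq> 0"
      using that disj[of g] \<open>0 \<in> T0\<close> by (auto simp: lA lB)
    then have w: "w g = 1 + lookup C g"
      by (simp add: w_def)
    have "lookup X g * (lookup X g - 3) \<ge> -2"
      using small[OF X_nonneg[of g]] by (auto split: if_splits)
    \<comment> \<open>Since \<open>w g = 1 + lookup C g\<close>, a positive
      \<open>lookup C g\<close> would make the expression in \<open>eq0\<close> positive. Then
      \<open>lookup X g\<close> is 1 or 2, and its residue \<open>1 - 0 - 0\<close> modulo 3 selects
      1.\<close>
    then have "lookup C g = 0"
      using eq0[of g] w lC[of g] by linarith
    moreover from this have "lookup X g * (lookup X g - 3) = -2"
      using eq0[of g] w by simp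
    then have "(lookup X g - 1) * (lookup X g - 2) = 0"
      by (simp add: algebra_simps)
    ultimately show ?thesis
      using X_mod[of g] g by auto
  qed
  have "lookup (X * B) 0 = (\<Sum>g\<in>UNIV. lookup B g)"
    unfolding lookup_mult_symmetric_0[OF symB] by (intro sum.cong refl) (auto simp: lB X_T1)
  also have "\<dots> = N + 1"
    using augB by (simp add: augmentation_def b)
  finally have "lookup (X * B) 0 = N + 1" .
  moreover have "X * B = S * ?H - S"
  proof -
    have "X * B = S * (A * B)"
      by (simp add: X_def ac_simps)
    then show ?thesis
      by (simp add: AB right_diff_distrib)
  qed
  \<comment> \<open>The coefficient of \<open>S * H - S\<close> at 0 is
    \<open>(2 * N + 1) - 1\<close>, which differs from \<open>N + 1\<close> as
    \<open>N > 1\<close>.\<close>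
  ultimately show False
    using N by (simp add: lookup_minus lookup_mult_set_elem_UNIV augS a b S0)
qed

end
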